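(* For all $n\in\mathbb{N}$ with $n\ge1$ and all $X\in\mathrm{IS}$: if $X\in\mathcal{C}_n$, then $X$ computes $\mathrm{tstnz}_n$.
   Context: Basic instructions: $\mathtt{in}{:}i.\mathtt{get}$ ($i\ge1$), $\mathtt{out}.\mathtt{set}{:}b$ ($b\in\{0,1\}$), $\mathtt{aux}{:}i.\mathtt{get}$ ($i\ge1$), $\mathtt{aux}{:}i.\mathtt{set}{:}b$ ($i\ge1$, $b\in\{0,1\}$). The part before the dot names a Boolean register ($\mathtt{in}{:}i$ input, $\mathtt{out}$ output, $\mathtt{aux}{:}i$ auxiliary); $\mathtt{get}$ changes nothing and replies the content, $\mathtt{set}{:}b$ makes the content $b$ and replies $b$. Primitive instructions: for each basic instruction $a$, plain $a$, positive test $+a$, negative test $-a$; forward jumps $\#l$ ($l\in\mathbb{N}$); termination $!$. $\mathrm{IS}$ is the set of finite sequences $X=u_1;\dots;u_k$ of primitive instructions, $\mathrm{len}(X)=k$. Execution starts at $u_1$: plain $a$ executes $a$ and proceeds with the next instruction; $+a$ executes $a$ and proceeds with the next instruction if the reply is $1$, otherwise skips the next one and proceeds with the one after it; $-a$ likewise with replies reversed; $\#l$ proceeds with the $l$-th next instruction; $!$ terminates. If $l=0$ or there is no instruction to proceed with, execution never terminates. For $f:\{0,1\}^n\to\{0,1\}$, $X$ computes $f$ if there is $k$ such that for all $b_1,\dots,b_n$, executing $X$ with $\mathtt{in}{:}i$ initially $b_i$, $\mathtt{out}$ and $\mathtt{aux}{:}1,\dots,\mathtt{aux}{:}k$ initially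 $0$ (other registers arbitrary) terminates with final content of $\mathtt{out}$ equal to $f(b_1,\dots,b_n)$. $\mathrm{tstnz}_n(b_1,\dots,b_n)=1$ iff some $b_i=1$. Notation: $;_{i=p}^{q}P_i$ denotes the concatenation $P_p;\dots;P_q$, which is empty if $p>q$. Write $r_i$ for $\mathtt{in}{:}i.\mathtt{get}$. The set $\mathcal{C}_n\subseteq\mathrm{IS}$ is defined as follows. For even $n$: $X\in\mathcal{C}_n$ iff $X={;}_{i=1}^{n/2}\big(-r_{\rho(2i-1)};+r_{\rho(2i)};\varphi(i)\big);!$ for some bijection $\rho$ of $\{1,\dots,n\}$ and some function $\varphi$ from $\{1,\dots,n/2\}$ to primitive instructions with $\varphi(j)\in\{\#3k: k\ge1, k\le n/2-j\}\cup\{\mathtt{out}.\mathtt{set}{:}1,+\mathtt{out}.\mathtt{set}{:}1,-\mathtt{out}.\mathtt{set}{:}1\}$ for all $j$, and $\varphi(n/2)\in\{\mathtt{out}.\mathtt{set}{:}1,+\mathtt{out}.\mathtt{set}{:}1\}$. For odd $n$: $X\in\mathcal{C}_n$ iff there exist $m\in\mathbb{N}$ with $m\le(n-1)/2$, a bijection $\rho$ of $\{1,\dots,n\}$ and a function $\varphi$ from $\{1,\dots,(n+1)/2\}$ to primitive instructions such that $X={;}_{i=1}^{m}\big(-r_{\rho(2i-1)};+r_{\rho(2i)};\varphi(i)\big);+r_{\rho(2m+1)};\varphi(m+1);{;}_{i=m+1}^{(n-1)/2}\big(-r_{\rho(2i)};+r_{\rho(2i+1)};\varphi(i+1)\big);!$,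 where for all $j$, $\varphi(j)\in\{\#(3k-1): k\ge1, k\le(n+1)/2-j, j\le m<j+k\}\cup\{\#3k: k\ge1, k\le(n+1)/2-j, \text{not } (j\le m<j+k)\}\cup\{\mathtt{out}.\mathtt{set}{:}1,+\mathtt{out}.\mathtt{set}{:}1,-\mathtt{out}.\mathtt{set}{:}1\}$, and $\varphi((n+1)/2)\in\{\mathtt{out}.\mathtt{set}{:}1,+\mathtt{out}.\mathtt{set}{:}1\}$. *)

theory Defs
  imports Main
begin

text \<open>Booleans encode bits: \<^term>\<open>True\<close> is 1 and \<^term>\<open>False\<close> is 0.\<close>

datatype reg = In nat | Out | Aux nat

type_synonym state = "reg \<Rightarrow> bool"

datatype basic = InGet nat | OutSet bool | AuxGet nat | AuxSet nat bool

datatype instr = Plain basic | PosTest basic | NegTest basic | Jump nat | Halt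

text \<open>Registers are numbered from 1; the datatypes also admit index 0, which is excluded here.\<close>

fun wf_basic :: "basic \<Rightarrow> bool" where
  "wf_basic (InGet i) \<longleftrightarrow> i \<ge> 1"
| "wf_basic (OutSet b) \<longleftrightarrow> True"
| "wf_basic (AuxGet i) \<longleftrightarrow> i \<ge> 1"
| "wf_basic (AuxSet i b) \<longleftrightarrow> i \<ge> 1"

fun wf_instr :: "instr \<Rightarrow> bool" where
  "wf_instr (Plain a) \<longleftrightarrow> wf_basic a"
| "wf_instr (PosTest a) \<longleftrightarrow> wf_basic a"
| "wf_instr (NegTest a) \<longleftrightarrow> wf_basic a"
| "wf_instr (Jump l) \<longleftrightarrow> True"
| "wf_instr Halt \<longleftrightarrow> True"

definition IS :: "instr list set" where
  "IS = {X. X \<noteq> [] \<and> (\<forall>u \<in> set X. wf_instr u)}"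

fun effect :: "basic \<Rightarrow> state \<Rightarrow> state" where
  "effect (InGet i) s = s"
| "effect (OutSet b) s = s(Out := b)"
| "effect (AuxGet i) s = s"
| "effect (AuxSet i b) s = s(Aux i := b)"

fun reply :: "basic \<Rightarrow> state \<Rightarrow> bool" where
  "reply (InGet i) s = s (In i)"
| "reply (OutSet b) s = b"
| "reply (AuxGet i) s = s (Aux i)"
| "reply (AuxSet i b) s = b"

text \<open>
  \<open>exec X p s s'\<close>: execution of \<open>X\<close> that proceeds with the instruction at (0-based) position \<open>p\<close>
  in state \<open>s\<close> terminates in state \<open>s'\<close>. Non-termination is the absence of a derivation; it
  covers a position outside \<open>X\<close> and the jump over distance 0.
\<close>

inductive exec :: "instr list \<Rightarrow> nat \<Rightarrow> state \<Rightarrow> state \<Rightarrow> bool" for X where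
  exec_halt: "p < length X \<Longrightarrow> X ! p = Halt \<Longrightarrow> exec X p s s"
| exec_plain: "p < length X \<Longrightarrow> X ! p = Plain a \<Longrightarrow>
    exec X (p + 1) (effect a s) s' \<Longrightarrow> exec X p s s'"
| exec_pos: "p < length X \<Longrightarrow> X ! p = PosTest a \<Longrightarrow>
    exec X (if reply a s then p + 1 else p + 2) (effect a s) s' \<Longrightarrow> exec X p s s'"
| exec_neg: "p < length X \<Longrightarrow> X ! p = NegTest a \<Longrightarrow>
    exec X (if reply a s then p + 2 else p + 1) (effect a s) s' \<Longrightarrow> exec X p s s'"
| exec_jump: "p < length X \<Longrightarrow> X ! p = Jump l \<Longrightarrow> l \<noteq> 0 \<Longrightarrow>
    exec X (p + l) s s' \<Longrightarrow> exec X p s s'"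

text \<open>
  An \<open>n\<close>-ary Boolean function is given by its values on lists of length \<open>n\<close>;
  \<open>bs ! (i - 1)\<close> is the \<open>i\<close>-th argument.
\<close>

definition computes :: "nat \<Rightarrow> instr list \<Rightarrow> (bool list \<Rightarrow> bool) \<Rightarrow> bool" where
  "computes n X f \<longleftrightarrow>
    (\<exists>k. \<forall>bs s. length bs = n \<longrightarrow>
       (\<forall>i\<in>{1..n}. s (In i) = bs ! (i - 1)) \<longrightarrow>
       \<not> s Out \<longrightarrow>
       (\<forall>i\<in>{1..k}. \<not> s (Aux i)) \<longrightarrow>
       (\<exists>s'. exec X 0 s s' \<and> s' Out = f bs))"

definition tstnz :: "nat \<Rightarrow> bool list \<Rightarrow> bool" where
  "tstnz n bs \<longleftrightarrow> (\<exists>i\<in>{1..n}. bs ! (i - 1))"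

definition seq_concat :: "nat \<Rightarrow> nat \<Rightarrow> (nat \<Rightarrow> instr list) \<Rightarrow> instr list" where
  "seq_concat p q P = concat (map P [p..<Suc q])"

definition out_set_1 :: "instr set" where
  "out_set_1 = {Plain (OutSet True), PosTest (OutSet True), NegTest (OutSet True)}"

definition C_even :: "nat \<Rightarrow> instr list set" where
  "C_even n = {X. \<exists>\<rho> \<phi>. bij_betw \<rho> {1..n} {1..n} \<and>
     X = seq_concat 1 (n div 2)
           (\<lambda>i. [NegTest (InGet (\<rho> (2 * i - 1))), PosTest (InGet (\<rho> (2 * i))), \<phi> i]) @ [Halt] \<and>
     (\<forall>j\<in>{1..n div 2}. \<phi> j \<in> {Jump (3 * k) |k. k \<ge> 1 \<and> k \<le> n div 2 - j} \<union> out_set_1) \<and>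
     \<phi> (n div 2) \<in> {Plain (OutSet True), PosTest (OutSet True)}}"

definition C_odd :: "nat \<Rightarrow> instr list set" where
  "C_odd n = {X. \<exists>m \<rho> \<phi>. m \<le> (n - 1) div 2 \<and> bij_betw \<rho> {1..n} {1..n} \<and>
     X = seq_concat 1 m
           (\<lambda>i. [NegTest (InGet (\<rho> (2 * i - 1))), PosTest (InGet (\<rho> (2 * i))), \<phi> i]) @
         [PosTest (InGet (\<rho> (2 * m + 1))), \<phi> (m + 1)] @
         seq_concat (m + 1) ((n - 1) div 2)
           (\<lambda>i. [NegTest (InGet (\<rho> (2 * i))), PosTest (InGet (\<rho> (2 * i + 1))), \<phi> (i + 1)]) @
         [Halt] \<and>
     (\<forall>j\<in>{1..(n + 1) div 2}. \<phi> j \<in>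
        {Jump (3 * k - 1) |k. k \<ge> 1 \<and> k \<le> (n + 1) div 2 - j \<and> (j \<le> m \<and> m < j + k)} \<union>
        {Jump (3 * k) |k. k \<ge> 1 \<and> k \<le> (n + 1) div 2 - j \<and> \<not> (j \<le> m \<and> m < j + k)} \<union>
        out_set_1) \<and>
     \<phi> ((n + 1) div 2) \<in> {Plain (OutSet True), PosTest (OutSet True)}}"

definition C :: "nat \<Rightarrow> instr list set" where
  "C n = (if even n then C_even n else C_odd n)"

end

theory Submission imports Defs begin

text \<open>
  Every program in \<open>C n\<close> is a sequence of blocks, each of which tests one or two input registers and
  reaches its last instruction \<open>\<phi> j\<close> iff one of them contains 1. A jump \<open>\<phi> j\<close> always lands on
  some later \<open>\<phi> i\<close>, and the last \<open>\<phi>\<close> is not a jump, so once some \<open>\<phi> j\<close> is reached the output is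
  set to 1, and it is never reset. A negative test \<open>\<phi> j\<close> enters the next block at its second
  instruction, which affects only tests that have become irrelevant.
\<close>

section \<open>Execution of a sequence of test blocks\<close>

text \<open>
  Blocks are counted from 0. Block \<open>j\<close> starts at position \<open>start j\<close> and its \<open>\<phi>\<close> is at position
  \<open>act j\<close>; \<open>start N\<close> is the position of the final termination instruction. Blocks testing a single
  register have \<open>a j = b j\<close>.
\<close>

locale test_blocks =
  fixes X :: "instr list" and N :: nat and start act a b :: "nat \<Rightarrow> nat"
  assumes start_less: "j \<le> N \<Longrightarrow> start j < length X"
    and halt: "X ! start N = Halt"
    and start_Suc: "j < N \<Longrightarrow> start (Suc j) = Suc (act j)"
    and block: "j < N \<Longrightarrow>
      act j = start j + 2 \<and> X ! start j = NegTest (InGet (a j)) \<and>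
        X ! Suc (start j) = PosTest (InGet (b j)) \<or>
      act j = start j + 1 \<and> X ! start j = PosTest (InGet (b j)) \<and> a j = b j"
    and act: "j < N \<Longrightarrow>
      X ! act j \<in> {Plain (OutSet True), PosTest (OutSet True)} \<or>
      X ! act j = NegTest (OutSet True) \<and> Suc j < N \<or>
      (\<exists>l i. X ! act j = Jump l \<and> l \<noteq> 0 \<and> j < i \<and> i < N \<and> act j + l = act i)"
begin

lemma act_less: "j < N \<Longrightarrow> act j < length X"
  using start_less[of "Suc j"] start_Suc[of j] by simp

text \<open>Both entry points must be treated together: a run from \<open>start j\<close> goes on at
  \<open>act j\<close> or at \<open>start (Suc j)\<close>, and a run from \<open>act j\<close> goes
  on in the next block or at a later \<open>act i\<close>. Jumps may skip many blocks, so the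
  induction on the number of remaining blocks is course-of-values. States are quantified inside
  because \<open>Out\<close> may change before the induction hypothesis is applied.\<close>

lemma exec_blocks:
  assumes "j \<le> N"
  shows "(\<forall>s. \<exists>s'. exec X (start j) s s' \<and>
           s' Out = (s Out \<or> (\<exists>i\<in>{j..<N}. s (In (a i)) \<or> s (In (b i))))) \<and>
         (j < N \<longrightarrow> (\<forall>s. \<exists>s'. exec X (act j) s s' \<and> s' Out))"
  using assms
proof (induction "N - j" arbitrary: j rule: less_induct)
  case less
  have start_IH: "\<exists>s'. exec X (start i) s s' \<and>
      s' Out = (s Out \<or> (\<exists>k\<in>{i..<N}. s (In (a k)) \<or> s (In (b k))))"
    if "j < i" "i \<le> N" for i s
    using less.hyps[of i] that by auto
  have act_IH: "\<exists>s'. exec X (act i) s s' \<and> s' Out" if "j < i" "i < N" for i s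
    using less.hyps[of i] that by auto
  show ?case
  proof (cases "j < N")
    case False
    with less.prems have "j = N" by simp
    then show ?thesis using exec_halt[OF start_less[of N] halt] by auto
  next
    case True
    have len: "act j < length X" "start j < length X"
      using act_less start_less True by auto
    have act_j: "\<exists>s'. exec X (act j) s s' \<and> s' Out" for s
    proof -
      let ?s = "s(Out := True)"
      \<comment> \<open>In \<open>?s\<close> the output is already 1, so the disjunct
        \<open>s Out\<close> of the hypothesis holds whatever the remaining inputs are.\<close>
      obtain s' where s': "exec X (Suc (act j)) ?s s'" "s' Out"
        using start_IH[of "Suc j" ?s] True start_Suc[of j] by auto
      consider "X ! act j = Plain (OutSet True)" | "X ! act j = PosTest (OutSet True)"
        | "X ! act j = NegTest (OutSet True)" "Suc j < N"
        | l i where "X ! act j = Jump l" "l \<noteq> 0" "j < i" "i < N" "act j + l = act i"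
        using act[OF True] by auto
      then show ?thesis
      proof cases
        case 1
        then show ?thesis using exec_plain[OF len(1) 1] s' by auto
      next
        case 2
        then show ?thesis using exec_pos[OF len(1) 2] s' by auto
      next
        case 3
        \<comment> \<open>The reply is 1, so the negative test skips the first instruction of the
          next block. It lands on the test of \<open>b (Suc j)\<close>, whose two outcomes lead to
          the runs \<open>t\<close> and \<open>u\<close>, or directly on \<open>act (Suc j)\<close>
          if the block tests a single register.\<close>
        have "\<exists>s'. exec X (act j + 2) ?s s' \<and> s' Out"
        proof -
          obtain t where t: "exec X (act (Suc j)) ?s t" "t Out"
            using act_IH[of "Suc j" ?s] 3 by auto
          obtain u where u: "exec X (Suc (act (Suc j))) ?s u" "u Out"
            using start_IH[of "Suc (Suc j)" ?s] 3 start_Suc[of "Suc j"] by auto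
          from block[OF 3(2)] show ?thesis
          proof (elim disjE conjE)
            assume *: "act (Suc j) = start (Suc j) + 2"
              "X ! Suc (start (Suc j)) = PosTest (InGet (b (Suc j)))"
            then have "Suc (start (Suc j)) < length X"
              using act_less[OF 3(2)] by simp
            from exec_pos[OF this *(2), of ?s] t u * show ?thesis
              using start_Suc[OF True]
              by (cases "?s (In (b (Suc j)))") (auto simp: numeral_2_eq_2 simp del: fun_upd_apply)
          next
            assume "act (Suc j) = start (Suc j) + 1"
            then show ?thesis using t start_Suc[OF True] by auto
          qed
        qed
        then show ?thesis using exec_neg[OF len(1) 3(1)] by auto
      next
        case 4
        then show ?thesis using exec_jump[OF len(1) 4(1,2)] act_IH[of i s] by auto
      qed
    qed
    moreover have "\<exists>s'. exec X (start j) s s' \<and>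
        s' Out = (s Out \<or> (\<exists>i\<in>{j..<N}. s (In (a i)) \<or> s (In (b i))))" for s
    proof -
      have split: "{j..<N} = insert j {Suc j..<N}" using True by auto
      \<comment> \<open>Input tests leave the state unchanged, so both possible continuations start
        in \<open>s\<close>: \<open>t\<close> reaches \<open>act j\<close>, and \<open>u\<close>
        bypasses it.\<close>
      obtain t where t: "exec X (act j) s t" "t Out" using act_j by blast
      obtain u where u: "exec X (Suc (act j)) s u"
        "u Out = (s Out \<or> (\<exists>i\<in>{Suc j..<N}. s (In (a i)) \<or> s (In (b i))))"
        using start_IH[of "Suc j" s] True start_Suc[of j] by auto
      from block[OF True] show ?thesis
      proof (elim disjE conjE)
        assume *: "act j = start j + 2" "X ! start j = NegTest (InGet (a j))"
          "X ! Suc (start j) = PosTest (InGet (b j))"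
        have "Suc (start j) < length X" using len * by simp
        note pos = exec_pos[OF this *(3), of s]
        note neg = exec_neg[OF len(2) *(2), of s]
        show ?thesis
        proof (cases "s (In (a j)) \<or> s (In (b j))")
          case sat: True
          \<comment> \<open>Content 1 in register \<open>a j\<close> makes the negative test skip
            straight to \<open>act j\<close>; otherwise the positive test finds 1 in register
            \<open>b j\<close> and proceeds to \<open>act j\<close>.\<close>
          have "exec X (start j) s t"
            using sat neg[of t] pos[of t] t * by (auto split: if_splits)
          then show ?thesis using t sat split by auto
        next
          case unsat: False
          have "exec X (start j) s u"
            using unsat neg[of u] pos[of u] u * by auto
          then show ?thesis using u unsat split by auto
        qed
      next
        assume *: "act j = start j + 1" "X ! start j = PosTest (InGet (b j))" "a j = b j"
        note pos = exec_pos[OF len(2) *(2), of s]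
        show ?thesis
        proof (cases "s (In (b j))")
          case sat: True
          then have "exec X (start j) s t" using pos[of t] t * by auto
          then show ?thesis using t sat split by auto
        next
          case unsat: False
          then have "exec X (start j) s u" using pos[of u] u * by auto
          then show ?thesis using u unsat split * by auto
        qed
      qed
    qed
    ultimately show ?thesis by blast
  qed
qed

lemma computes_tstnz:
  assumes "start 0 = 0" and tested: "(\<Union>j<N. {a j, b j}) = {1..n}"
  shows "computes n X (tstnz n)"
  \<comment> \<open>The bound 0 imposes nothing on auxiliary registers: blocks access only input
    registers and \<open>Out\<close>.\<close>
  unfolding computes_def
proof (intro exI[of _ 0] allI impI)
  fix bs s
  assume inp: "\<forall>i\<in>{1..n}. s (In i) = bs ! (i - 1)" and "\<not> s Out"
  obtain s' where s': "exec X 0 s s'"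
    "s' Out = (s Out \<or> (\<exists>i\<in>{0..<N}. s (In (a i)) \<or> s (In (b i))))"
    using exec_blocks[OF le0, THEN conjunct1, THEN spec, of s] assms(1) by metis
  have "(\<exists>i\<in>{0..<N}. s (In (a i)) \<or> s (In (b i))) \<longleftrightarrow>
      (\<exists>r\<in>(\<Union>j<N. {a j, b j}). s (In r))"
    by (simp add: lessThan_atLeast0)
  also have "\<dots> \<longleftrightarrow> tstnz n bs"
    unfolding tested tstnz_def using inp by (intro bex_cong) auto
  finally show "\<exists>s'. exec X 0 s s' \<and> s' Out = tstnz n bs"
    using s' \<open>\<not> s Out\<close> by metis
qed

end

section \<open>Positions in concatenations of pieces of length 3\<close>

lemma length_seq_concat_3:
  assumes "\<And>i. length (P i) = 3"
  shows "length (seq_concat p q P) = 3 * (Suc q - p)"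
  using assms by (simp add: seq_concat_def length_concat comp_def sum_list_triv del: upt_Suc)

lemma nth_concat_map_3:
  assumes "\<And>i. length (P i) = 3" and "j < length xs" and "r < 3"
  shows "concat (map P xs) ! (3 * j + r) = P (xs ! j) ! r"
  using assms(2)
proof (induction xs arbitrary: j)
  case (Cons x xs)
  then show ?case using assms(1,3) by (cases j) (auto simp: nth_append)
qed simp

lemma nth_seq_concat_3:
  assumes "\<And>i. length (P i) = 3" and "p + j \<le> q" and "r < 3"
  shows "seq_concat p q P ! (3 * j + r) = P (p + j) ! r"
  using assms nth_concat_map_3[of P j "[p..<Suc q]" r]
  by (simp add: seq_concat_def del: upt_Suc)

section \<open>Even number of inputs\<close>

lemma C_even_computes_tstnz:
  assumes "even n" "n \<ge> 1" "X \<in> C_even n"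
  shows "computes n X (tstnz n)"
proof -
  define N where "N = n div 2"
  have n: "n = 2 * N" "N \<ge> 1" using assms(1,2) by (auto simp: N_def)
  obtain \<rho> \<phi> where bij: "bij_betw \<rho> {1..n} {1..n}"
    and X: "X = seq_concat 1 N
      (\<lambda>i. [NegTest (InGet (\<rho> (2 * i - 1))), PosTest (InGet (\<rho> (2 * i))), \<phi> i]) @ [Halt]"
    and \<phi>: "\<And>j. j \<in> {1..N} \<Longrightarrow> \<phi> j \<in> {Jump (3 * k) |k. k \<ge> 1 \<and> k \<le> N - j} \<union> out_set_1"
    and \<phi>_last: "\<phi> N \<in> {Plain (OutSet True), PosTest (OutSet True)}"
    using assms(3) unfolding C_even_def N_def by auto
  have len: "length X = 3 * N + 1" by (simp add: X length_seq_concat_3)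
  \<comment> \<open>Block \<open>j\<close> counted from 0 is piece \<open>i = j + 1\<close> of the
    program, which turns \<open>2 * i - 1\<close> and \<open>2 * i\<close> into
    \<open>2 * j + 1\<close> and \<open>2 * j + 2\<close>.\<close>
  have nth: "X ! (3 * j + r) =
      [NegTest (InGet (\<rho> (2 * j + 1))), PosTest (InGet (\<rho> (2 * j + 2))), \<phi> (Suc j)] ! r"
    if "j < N" "r < 3" for j r
    unfolding X using that
    by (simp add: nth_append length_seq_concat_3 nth_seq_concat_3)
  interpret test_blocks X N "\<lambda>j. 3 * j" "\<lambda>j. 3 * j + 2"
    "\<lambda>j. \<rho> (2 * j + 1)" "\<lambda>j. \<rho> (2 * j + 2)"
  proof
    show "X ! (3 * N) = Halt" by (simp add: X nth_append length_seq_concat_3)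
  next
    fix j assume j: "j < N"
    show "3 * j + 2 = 3 * j + 2 \<and> X ! (3 * j) = NegTest (InGet (\<rho> (2 * j + 1))) \<and>
        X ! Suc (3 * j) = PosTest (InGet (\<rho> (2 * j + 2))) \<or>
      3 * j + 2 = 3 * j + 1 \<and> X ! (3 * j) = PosTest (InGet (\<rho> (2 * j + 2))) \<and>
        \<rho> (2 * j + 1) = \<rho> (2 * j + 2)"
      using nth[OF j, of 0] nth[OF j, of 1] by simp
    have eq: "X ! (3 * j + 2) = \<phi> (Suc j)" using nth[OF j, of 2] by simp
    show "X ! (3 * j + 2) \<in> {Plain (OutSet True), PosTest (OutSet True)} \<or>
      X ! (3 * j + 2) = NegTest (OutSet True) \<and> Suc j < N \<or>
      (\<exists>l i. X ! (3 * j + 2) = Jump l \<and> l \<noteq> 0 \<and> j < i \<and> i < N \<and> 3 * j + 2 + l = 3 * i + 2)"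
    proof (cases "Suc j = N")
      case True
      then show ?thesis using \<phi>_last eq by auto
    next
      case False
      consider "\<phi> (Suc j) \<in> out_set_1" | k where "\<phi> (Suc j) = Jump (3 * k)" "k \<ge> 1" "k \<le> N - Suc j"
        using \<phi>[of "Suc j"] j by auto
      then show ?thesis
      proof cases
        case 1
        then show ?thesis using eq j False by (auto simp: out_set_1_def)
      next
        case 2
        \<comment> \<open>Successive values of \<open>act\<close> differ by 3, so the target is
          block \<open>j + k\<close>; the bound on \<open>k\<close> keeps it below
          \<open>N\<close>.\<close>
        then have "X ! (3 * j + 2) = Jump (3 * k) \<and> 3 * k \<noteq> 0 \<and> j < j + k \<and> j + k < N \<and>
            3 * j + 2 + 3 * k = 3 * (j + k) + 2"
          using eq j by auto
        then show ?thesis by blast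
      qed
    qed
  qed (auto simp: len)
  show ?thesis
  proof (rule computes_tstnz)
    have "{1..n} = (\<Union>j<N. {2 * j + 1, 2 * j + 2})"
    proof (intro equalityI subsetI)
      fix i assume "i \<in> {1..n}"
      then have "(i - 1) div 2 < N" "i = 2 * ((i - 1) div 2) + 1 \<or> i = 2 * ((i - 1) div 2) + 2"
        using n by auto
      then show "i \<in> (\<Union>j<N. {2 * j + 1, 2 * j + 2})" by blast
    qed (use n in auto)
    then have "\<rho> ` {1..n} = (\<Union>j<N. {\<rho> (2 * j + 1), \<rho> (2 * j + 2)})"
      by (simp add: image_UN)
    then show "(\<Union>j<N. {\<rho> (2 * j + 1), \<rho> (2 * j + 2)}) = {1..n}"
      using bij by (simp add: bij_betw_def)
  qed simp
qed

section \<open>Odd number of inputs\<close>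

lemma C_odd_computes_tstnz:
  assumes "odd n" "X \<in> C_odd n"
  shows "computes n X (tstnz n)"
proof -
  define M where "M = (n - 1) div 2"
  have n: "n = 2 * M + 1" "(n + 1) div 2 = Suc M" using assms(1) by (auto simp: M_def elim: oddE)
  obtain m \<rho> \<phi> where m: "m \<le> M" and bij: "bij_betw \<rho> {1..n} {1..n}"
    and X: "X = seq_concat 1 m
        (\<lambda>i. [NegTest (InGet (\<rho> (2 * i - 1))), PosTest (InGet (\<rho> (2 * i))), \<phi> i]) @
      [PosTest (InGet (\<rho> (2 * m + 1))), \<phi> (m + 1)] @
      seq_concat (m + 1) M
        (\<lambda>i. [NegTest (InGet (\<rho> (2 * i))), PosTest (InGet (\<rho> (2 * i + 1))), \<phi> (i + 1)]) @
      [Halt]"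
    and \<phi>: "\<And>j. j \<in> {1..Suc M} \<Longrightarrow> \<phi> j \<in>
      {Jump (3 * k - 1) |k. k \<ge> 1 \<and> k \<le> Suc M - j \<and> (j \<le> m \<and> m < j + k)} \<union>
      {Jump (3 * k) |k. k \<ge> 1 \<and> k \<le> Suc M - j \<and> \<not> (j \<le> m \<and> m < j + k)} \<union> out_set_1"
    and \<phi>_last: "\<phi> (Suc M) \<in> {Plain (OutSet True), PosTest (OutSet True)}"
    using assms(2) unfolding C_odd_def M_def[symmetric] n(2) by blast
  \<comment> \<open>Block \<open>m\<close> has only two instructions, so every later block starts
    one position earlier than \<open>3 * j\<close>. The subtraction is never truncated, as
    \<open>j > m\<close> there. Likewise later register indices drop by one, and in block
    \<open>m\<close> both \<open>a\<close> and \<open>b\<close> give \<rho> at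
    \<open>2 * m + 1\<close>.\<close>
  define start where "start j = (if j \<le> m then 3 * j else 3 * j - 1)" for j
  define act where "act j = (if j < m then 3 * j + 2 else 3 * j + 1)" for j
  define a where "a j = \<rho> (if j \<le> m then 2 * j + 1 else 2 * j)" for j
  define b where "b j = \<rho> (if j < m then 2 * j + 2 else 2 * j + 1)" for j
  have len: "length X = 3 * M + 3" using m by (simp add: X length_seq_concat_3)
  have nth1: "X ! (3 * j + r) =
      [NegTest (InGet (\<rho> (2 * j + 1))), PosTest (InGet (\<rho> (2 * j + 2))), \<phi> (Suc j)] ! r"
    if "j < m" "r < 3" for j r
    unfolding X using that
    by (simp add: nth_append length_seq_concat_3 nth_seq_concat_3)
  have nth2: "X ! (3 * m) = PosTest (InGet (\<rho> (2 * m + 1)))" "X ! (3 * m + 1) = \<phi> (Suc m)"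
    unfolding X by (simp_all add: nth_append length_seq_concat_3)
  have nth3: "X ! (3 * j - 1 + r) =
      [NegTest (InGet (\<rho> (2 * j))), PosTest (InGet (\<rho> (2 * j + 1))), \<phi> (Suc j)] ! r"
    if "m < j" "j \<le> M" "r < 3" for j r
  proof -
    \<comment> \<open>\<open>d\<close> counts blocks within the second concatenation, which begins
      at position \<open>3 * m + 2\<close>.\<close>
    define d where "d = j - Suc m"
    have d: "j = m + 1 + d" "m + 1 + d \<le> M" using that by (auto simp: d_def)
    have "3 * j - 1 + r = 3 * m + 2 + (3 * d + r)" by (simp add: d)
    moreover have "3 * d + r < 3 * (M - m)" using d that by linarith
    ultimately show ?thesis
      unfolding X using that d
      by (simp add: nth_append length_seq_concat_3 nth_seq_concat_3)
  qed
  have nth_act: "X ! act j = \<phi> (Suc j)" if "j < Suc M" for j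
    using nth1[of j 2] nth2 nth3[of j 2] that by (cases j m rule: linorder_cases) (auto simp: act_def)
  interpret test_blocks X "Suc M" start act a b
  proof
    show "X ! start (Suc M) = Halt"
      using m by (simp add: X nth_append length_seq_concat_3 start_def diff_mult_distrib2)
  next
    fix j assume j: "j < Suc M"
    show "act j = start j + 2 \<and> X ! start j = NegTest (InGet (a j)) \<and>
        X ! Suc (start j) = PosTest (InGet (b j)) \<or>
      act j = start j + 1 \<and> X ! start j = PosTest (InGet (b j)) \<and> a j = b j"
    proof (cases j m rule: linorder_cases)
      case less
      then show ?thesis using nth1[OF less, of 0] nth1[OF less, of 1]
        by (simp add: start_def act_def a_def b_def)
    next
      case equal
      then show ?thesis using nth2 by (simp add: start_def act_def a_def b_def)
    next
      case greater
      then show ?thesis using nth3[OF greater, of 0] nth3[OF greater, of 1] j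
        by (simp add: start_def act_def a_def b_def)
    qed
    show "X ! act j \<in> {Plain (OutSet True), PosTest (OutSet True)} \<or>
      X ! act j = NegTest (OutSet True) \<and> Suc j < Suc M \<or>
      (\<exists>l i. X ! act j = Jump l \<and> l \<noteq> 0 \<and> j < i \<and> i < Suc M \<and> act j + l = act i)"
    proof (cases "j = M")
      case True
      then show ?thesis using \<phi>_last nth_act[OF j] by auto
    next
      case False
      \<comment> \<open>With blocks counted from 0, the side condition reads \<open>j < m\<close>
        and \<open>m \<le> j + k\<close>: the jump ends at or beyond the short block. Exactly then
        \<open>act (j + k)\<close> is only \<open>3 * k - 1\<close> ahead of
        \<open>act j\<close>.\<close>
      consider "\<phi> (Suc j) \<in> out_set_1"
        | k where "\<phi> (Suc j) = Jump (3 * k - 1)" "k \<ge> 1" "k \<le> M - j" "j < m" "m \<le> j + k"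
        | k where "\<phi> (Suc j) = Jump (3 * k)" "k \<ge> 1" "k \<le> M - j" "\<not> (j < m \<and> m \<le> j + k)"
        using \<phi>[of "Suc j"] j by (auto simp: Suc_le_eq less_Suc_eq_le)
      then show ?thesis
      proof cases
        case 1
        then show ?thesis using nth_act[OF j] j False by (auto simp: out_set_1_def)
      next
        case 2
        then have "X ! act j = Jump (3 * k - 1) \<and> 3 * k - 1 \<noteq> 0 \<and> j < j + k \<and> j + k < Suc M \<and>
            act j + (3 * k - 1) = act (j + k)"
          using nth_act[OF j] j by (auto simp: act_def)
        then show ?thesis by blast
      next
        case 3
        then have "X ! act j = Jump (3 * k) \<and> 3 * k \<noteq> 0 \<and> j < j + k \<and> j + k < Suc M \<and>
            act j + 3 * k = act (j + k)"
          using nth_act[OF j] j by (auto simp: act_def)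
        then show ?thesis by blast
      qed
    qed
  qed (use m in \<open>auto simp: len start_def act_def\<close>)
  show ?thesis
  proof (rule computes_tstnz)
    let ?A = "\<lambda>j. {if j \<le> m then 2 * j + 1 else 2 * j, if j < m then 2 * j + 2 else 2 * j + 1}"
    have "{1..n} = (\<Union>j<Suc M. ?A j)"
    proof (intro equalityI subsetI)
      fix i assume i: "i \<in> {1..n}"
      show "i \<in> (\<Union>j<Suc M. ?A j)"
      \<comment> \<open>Indices up to \<open>2 * m\<close> pair up as in the even case; from
        \<open>2 * m + 1\<close> on, index \<open>i\<close> belongs to block
        \<open>i div 2\<close>.\<close>
      proof (cases "i \<le> 2 * m")
        case True
        then have "(i - 1) div 2 < m" "i = 2 * ((i - 1) div 2) + 1 \<or> i = 2 * ((i - 1) div 2) + 2"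
          using i by auto
        then have "i \<in> ?A ((i - 1) div 2)" "(i - 1) div 2 < Suc M" using m by auto
        then show ?thesis by blast
      next
        case False
        then have "i div 2 \<ge> m" "i = 2 * (i div 2) \<and> i div 2 > m \<or> i = 2 * (i div 2) + 1"
          by presburger+
        moreover have "i div 2 < Suc M" using i n by auto
        ultimately have "i \<in> ?A (i div 2)" "i div 2 < Suc M" by auto
        then show ?thesis by blast
      qed
    qed (use n m in \<open>auto split: if_splits\<close>)
    then have "\<rho> ` {1..n} = (\<Union>j<Suc M. {a j, b j})"
      by (simp add: image_UN a_def b_def)
    then show "(\<Union>j<Suc M. {a j, b j}) = {1..n}"
      using bij by (simp add: bij_betw_def)
  qed (simp add: start_def)
qed

theorem theorem2:
  fixes n :: nat and X :: "instr list"
  assumes "n \<ge> 1" and "X \<in> IS" and "X \<in> C n"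
  shows "computes n X (tstnz n)"
  using assms C_even_computes_tstnz C_odd_computes_tstnz
  by (auto simp: C_def split: if_splits)

end
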